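(* For every $n<\omega$, the Partition Hypothesis $\mathrm{PH}_n(\omega_n)$ fails, where $\omega_n$ carries its usual ordinal ordering.
   Context: Let $\Lambda$ be a directed quasi-order and $1\le n<\omega$. $\Lambda^{\le n}$ is the set of finite sequences from $\Lambda$ of length between $1$ and $n$. For $\vec x,\vec y\in\Lambda^{\le n}$, $\vec x\trianglelefteq\vec y$ means $\vec x$ is a (not necessarily initial) subsequence of $\vec y$, and $\vec x\triangleleft\vec y$ means a proper subsequence. A function $F\colon\Lambda^{\le n}\to\Lambda$ is $n$-cofinal if $x\le F(\langle x\rangle)$ for all $x\in\Lambda$ and $F(\vec x)\le F(\vec y)$ whenever $\vec x\trianglelefteq\vec y$. $\Lambda^{\llbracket n\rrbracket}$ is the set of $\sigma\in\prod_{i<n}\Lambda^{i+1}$ that are $\trianglelefteq$-increasing ($\sigma(0)\trianglelefteq\sigma(1)\trianglelefteq\cdots$). For $n$-cofinal $F$, $F^*\colon\Lambda^{\llbracket n\rrbracket}\to\Lambda^n$ is $F^*(\sigma)=\langle F(\sigma(i)):i<n\rangle$. For $n<\omega$, $\mathrm{PH}_n(\Lambda)$ is the assertion: for every $c\colon\Lambda^{n+1}\to\omega$ there is an $(n+1)$-cofinal $F\colon\Lambda^{\le n+1}\to\Lambda$ such that $c\circ F^*\colon\Lambda^{\llbracket n+1\rrbracket}\to\omega$ is constant. *)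

theory Defs
  imports Main "HOL-Library.Sublist"
begin

unbundle cardinal_syntax

text \<open>
  A quasi-order is given by its order relation \<open>r\<close>, where \<open>(x, y) \<in> r\<close> means that
  \<open>x\<close> is below or equal to \<open>y\<close>; its underlying set is \<open>Field r\<close>.
\<close>

definition directed_quasi_order :: "'a rel \<Rightarrow> bool" where
  "directed_quasi_order r \<longleftrightarrow>
     Preorder r \<and> (\<forall>x\<in>Field r. \<forall>y\<in>Field r. \<exists>z\<in>Field r. (x, z) \<in> r \<and> (y, z) \<in> r)"

definition tuples :: "'a set \<Rightarrow> nat \<Rightarrow> 'a list set" where
  "tuples A n = {xs. length xs = n \<and> set xs \<subseteq> A}"

definition tuples_upto :: "'a set \<Rightarrow> nat \<Rightarrow> 'a list set" where
  "tuples_upto A n = {xs. 1 \<le> length xs \<and> length xs \<le> n \<and> set xs \<subseteq> A}"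

text \<open>
  The library relation \<^const>\<open>subseq\<close> is the (not necessarily contiguous) subsequence
  relation on lists.
\<close>

definition n_cofinal :: "'a rel \<Rightarrow> nat \<Rightarrow> ('a list \<Rightarrow> 'a) \<Rightarrow> bool" where
  "n_cofinal r n F \<longleftrightarrow>
     (\<forall>xs \<in> tuples_upto (Field r) n. F xs \<in> Field r) \<and>
     (\<forall>x \<in> Field r. (x, F [x]) \<in> r) \<and>
     (\<forall>xs \<in> tuples_upto (Field r) n. \<forall>ys \<in> tuples_upto (Field r) n.
        subseq xs ys \<longrightarrow> (F xs, F ys) \<in> r)"

text \<open>
  An element of the product of the sets \<open>tuples A (i + 1)\<close>, for \<open>i < n\<close>, is a list of lists
  of length \<open>n\<close>.
\<close>

definition increasing_chains :: "'a set \<Rightarrow> nat \<Rightarrow> 'a list list set" where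
  "increasing_chains A n =
     {\<sigma>. length \<sigma> = n \<and> (\<forall>i<n. \<sigma> ! i \<in> tuples A (i + 1)) \<and>
         (\<forall>i. i + 1 < n \<longrightarrow> subseq (\<sigma> ! i) (\<sigma> ! (i + 1)))}"

definition star :: "('a list \<Rightarrow> 'a) \<Rightarrow> 'a list list \<Rightarrow> 'a list" where
  "star F \<sigma> = map F \<sigma>"

text \<open>
  The colouring \<open>c\<close> and the function \<open>F\<close> are total functions on lists of which only the
  values on \<open>tuples (Field r) (n + 1)\<close> and \<open>tuples_upto (Field r) (n + 1)\<close>, respectively,
  matter.
\<close>

definition PH :: "nat \<Rightarrow> 'a rel \<Rightarrow> bool" where
  "PH n r \<longleftrightarrow>
     (\<forall>c :: 'a list \<Rightarrow> nat. \<exists>F. n_cofinal r (n + 1) F \<and>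
        (\<exists>k. \<forall>\<sigma> \<in> increasing_chains (Field r) (n + 1). (c \<circ> star F) \<sigma> = k))"

text \<open>
  \<open>is_omega n r\<close> says that \<open>r\<close> is a well-order isomorphic to the \<open>n\<close>-th infinite initial
  ordinal. Since the library operator \<^const>\<open>cardSuc\<close> changes the type of the relation, it
  cannot be iterated \<open>n\<close> times for a variable \<open>n\<close>; the recursion therefore passes through an
  isomorphic copy of the predecessor on the type of \<open>r\<close> itself. Such a copy always exists,
  and the lemmas below show that \<open>is_omega n\<close> determines \<open>r\<close> up to isomorphism, independently
  of its type, and that every \<open>n\<close> is realised on some type.
\<close>

primrec is_omega :: "nat \<Rightarrow> 'a rel \<Rightarrow> bool" where
  "is_omega 0 r \<longleftrightarrow> r =o natLeq"
| "is_omega (Suc n) r \<longleftrightarrow> (\<exists>s :: 'a rel. is_omega n s \<and> r =o cardSuc s)"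

lemma is_omega_Card_order:
  fixes r :: "'a rel"
  shows "is_omega n r \<Longrightarrow> Card_order r"
proof (induction n arbitrary: r)
  case 0
  then have "r =o natLeq"
    by simp
  then show ?case
    by (rule Card_order_ordIso[OF natLeq_Card_order])
next
  case (Suc n)
  obtain s :: "'a rel" where s: "is_omega n s" "r =o cardSuc s"
    using Suc.prems unfolding is_omega.simps by blast
  show ?case
    by (rule Card_order_ordIso[OF cardSuc_Card_order[OF Suc.IH[OF s(1)]] s(2)])
qed

lemma is_omega_unique:
  fixes r :: "'a rel" and r' :: "'b rel"
  shows "is_omega n r \<Longrightarrow> is_omega n r' \<Longrightarrow> r =o r'"
proof (induction n arbitrary: r r')
  case 0
  then have "r =o natLeq" "r' =o natLeq"
    by simp_all
  then show ?case
    using ordIso_transitive[OF _ ordIso_symmetric] by blast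
next
  case (Suc n)
  obtain s :: "'a rel" where s: "is_omega n s" "r =o cardSuc s"
    using Suc.prems(1) unfolding is_omega.simps by blast
  obtain s' :: "'b rel" where s': "is_omega n s'" "r' =o cardSuc s'"
    using Suc.prems(2) unfolding is_omega.simps by blast
  have "cardSuc s =o cardSuc s'"
    using Suc.IH[OF s(1) s'(1)]
    by (simp add: cardSuc_invar_ordIso is_omega_Card_order[OF s(1)] is_omega_Card_order[OF s'(1)])
  then show ?case
    by (rule ordIso_transitive[OF s(2) ordIso_transitive[OF _ ordIso_symmetric[OF s'(2)]]])
qed

lemma is_omega_ordIso:
  fixes r :: "'a rel" and r' :: "'b rel"
  shows "is_omega n r \<Longrightarrow> r =o r' \<Longrightarrow> is_omega n r'"
proof (induction n arbitrary: r r')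
  case 0
  then have "r =o natLeq"
    by simp
  then show ?case
    using ordIso_transitive[OF ordIso_symmetric[OF "0.prems"(2)]] by simp
next
  case (Suc n)
  obtain s :: "'a rel" where s: "is_omega n s" "r =o cardSuc s"
    using Suc.prems(1) unfolding is_omega.simps by blast
  have r': "r' =o cardSuc s"
    by (rule ordIso_transitive[OF ordIso_symmetric[OF Suc.prems(2)] s(2)])
  have "s <o r'"
    by (rule ordLess_ordIso_trans[OF cardSuc_greater[OF is_omega_Card_order[OF s(1)]]
          ordIso_symmetric[OF r']])
  then obtain s' :: "'b rel" where s': "s =o s'"
    using iffD1[OF internalize_ordLess] by blast
  have "is_omega n s'"
    by (rule Suc.IH[OF s(1) s'])
  moreover have "cardSuc s =o cardSuc s'"
    using s' by (simp add: cardSuc_invar_ordIso is_omega_Card_order[OF s(1)]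
        is_omega_Card_order[OF \<open>is_omega n s'\<close>])
  then have "r' =o cardSuc s'"
    by (rule ordIso_transitive[OF r'])
  ultimately show ?case
    unfolding is_omega.simps by blast
qed

lemma is_omega_0: "is_omega 0 natLeq"
  by (simp add: ordIso_reflexive[OF natLeq_Well_order])

lemma is_omega_Suc_cardSuc:
  fixes r :: "'a rel"
  assumes "is_omega n r"
  shows "is_omega (Suc n) (cardSuc r)"
proof -
  have r: "Card_order r"
    by (rule is_omega_Card_order[OF assms])
  obtain s :: "'a set rel" where s: "r =o s"
    using iffD1[OF internalize_ordLess cardSuc_greater[OF r]] by blast
  have "is_omega n s"
    by (rule is_omega_ordIso[OF assms s])
  moreover have "cardSuc r =o cardSuc s"
    using s by (simp add: cardSuc_invar_ordIso r is_omega_Card_order[OF \<open>is_omega n s\<close>])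
  ultimately show ?thesis
    unfolding is_omega.simps by blast
qed

lemma is_omega_directed_quasi_order:
  assumes "is_omega n r"
  shows "directed_quasi_order r"
proof -
  have "Well_order r"
    using card_order_on_well_order_on[OF is_omega_Card_order[OF assms]] .
  then have p: "Preorder r" and refl: "refl_on (Field r) r" and t: "Total r"
    by (simp_all add: order_on_defs)
  have "\<exists>z\<in>Field r. (x, z) \<in> r \<and> (y, z) \<in> r" if xy: "x \<in> Field r" "y \<in> Field r" for x y
  proof -
    have "(x, x) \<in> r" "(y, y) \<in> r"
      using refl_onD[OF refl] xy by simp_all
    moreover from this have "(x, y) \<in> r \<or> (y, x) \<in> r"
      using t xy unfolding total_on_def by (cases "x = y") simp_all
    ultimately show ?thesis
      using xy by (elim disjE) (rule bexI, rule conjI, assumption+)+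
  qed
  then show ?thesis
    using p unfolding directed_quasi_order_def by simp
qed

end

theory Submission
  imports Defs "HOL-Library.Nat_Bijection"
begin

text \<open>
  Following Kuratowski and Sierpinski, \<open>(n + 1)\<close>-tuples from \<open>\<omega>\<^sub>n\<close> can be coloured by
  countably many colours, each of which carries a direction \<open>k \<le> n\<close>, such that every line in
  direction \<open>k\<close> meets the colour class in at most one point: remove the largest entry \<open>\<beta>\<close>
  of the tuple, map the other entries into \<open>\<omega>\<^sub>n\<^sub>-\<^sub>1\<close> by an injection of the initial segment up
  to \<open>\<beta>\<close>, and recurse. If \<open>F\<close> makes this colouring constant, with direction \<open>k\<close>, then
  \<open>F (\<sigma> ! k)\<close> depends only on the other entries of the chain \<open>\<sigma>\<close>. Replacing letters one by
  one, \<open>F\<close> takes the same value on \<open>\<langle>a, \<dots>, a\<rangle>\<close> and \<open>\<langle>b, \<dots>, b\<rangle>\<close> (words of length \<open>k + 1\<close>)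
  for all \<open>a\<close> and \<open>b\<close>; this value bounds \<open>\<omega>\<^sub>n\<close>, which is impossible.
\<close>

section \<open>Infinite cardinals as well-orders\<close>

lemma is_omega_Cinfinite:
  fixes r :: "'a rel"
  shows "is_omega n r \<Longrightarrow> Cinfinite r"
proof (induction n arbitrary: r)
  case 0
  then show ?case
    using Cinfinite_cong[OF ordIso_symmetric natLeq_Cinfinite] by simp
next
  case (Suc n)
  then obtain s :: "'a rel" where s: "is_omega n s" "r =o cardSuc s"
    by auto
  show ?case
    by (rule Cinfinite_cong[OF ordIso_symmetric[OF s(2)] Cinfinite_cardSuc[OF Suc.IH[OF s(1)]]])
qed

lemma Card_order_total:
  assumes "Card_order r" "x \<in> Field r" "y \<in> Field r"
  shows "(x, y) \<in> r \<or> (y, x) \<in> r"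
proof -
  have "Total r" "Refl r"
    using card_order_on_well_order_on[OF assms(1)] by (simp_all add: order_on_defs)
  then show ?thesis
    using assms(2,3) by (metis refl_onD total_on_def)
qed

lemma Card_order_finite_max:
  assumes r: "Card_order r" and "\<forall>i\<le>n. x i \<in> Field r"
  shows "\<exists>p\<le>n::nat. \<forall>i\<le>n. (x i, x p) \<in> r"
  using assms(2)
proof (induction n)
  case 0
  then show ?case
    using Card_order_total[OF r] by auto
next
  case (Suc n)
  have "trans r"
    using card_order_on_well_order_on[OF r] by (simp add: order_on_defs)
  obtain p where p: "p \<le> n" "\<forall>i\<le>n. (x i, x p) \<in> r"
    using Suc by auto
  consider "(x p, x (Suc n)) \<in> r" | "(x (Suc n), x p) \<in> r"
    using Card_order_total[OF r, of "x p" "x (Suc n)"] Suc.prems p(1) by auto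
  then show ?case
  proof cases
    case 1
    have "(x i, x (Suc n)) \<in> r" if "i \<le> Suc n" for i
      using that p(2) 1 \<open>trans r\<close> Card_order_total[OF r, of "x (Suc n)" "x (Suc n)"] Suc.prems
      by (metis le_Suc_eq transD)
    then show ?thesis
      by blast
  next
    case 2
    then show ?thesis
      using p by (metis le_Suc_eq)
  qed
qed

text \<open>An infinite cardinal has no largest element, so the closed segment up to
  \<open>b\<close> lies in the open segment below some larger \<open>d\<close>. That is smaller than
  \<open>r\<close>, the successor of \<open>s\<close>, hence has size at most \<open>s\<close>.
  Closed segments are used because the maximum of a tuple may be repeated.\<close>

lemma inj_on_under_predecessor:
  fixes r s :: "'a rel"
  assumes r: "Cinfinite r" and s: "Card_order s" and rs: "r =o cardSuc s" and b: "b \<in> Field r"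
  shows "\<exists>e. inj_on e (under r b) \<and> e ` under r b \<subseteq> Field s"
proof -
  have "Well_order r"
    using card_order_on_well_order_on r by blast
  then have order: "trans r" "antisym r"
    by (simp_all add: order_on_defs)
  obtain d where d: "d \<in> Field r" "b \<noteq> d" "(b, d) \<in> r"
    using infinite_Card_order_limit[OF _ _ b] r unfolding cinfinite_def by blast
  have "under r b \<subseteq> underS r d"
    using d order unfolding under_def underS_def trans_def antisym_def by blast
  then have "|under r b| \<le>o |underS r d|"
    by (rule card_of_mono1)
  moreover have "|underS r d| <o r"
    by (rule card_of_underS[OF conjunct2[OF r] d(1)])
  ultimately have "|under r b| <o cardSuc s"
    by (rule ordLess_ordIso_trans[OF ordLeq_ordLess_trans rs])
  then have "|under r b| \<le>o s"
    by (simp add: cardSuc_ordLeq_ordLess[OF s card_of_Card_order])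
  then have "|under r b| \<le>o |Field s|"
    by (rule ordLeq_ordIso_trans[OF _ ordIso_symmetric[OF card_of_Field_ordIso[OF s]]])
  then show ?thesis
    unfolding card_of_ordLeq[symmetric] .
qed

section \<open>Kuratowski-Sierpinski colourings\<close>

text \<open>
  A colour is a pair of a direction and a label. A tuple is a function of which only the values
  at the indices up to \<open>n\<close> matter.
\<close>

definition line_separating :: "'a set \<Rightarrow> nat \<Rightarrow> ((nat \<Rightarrow> 'a) \<Rightarrow> nat \<times> nat) \<Rightarrow> bool" where
  "line_separating A n C \<longleftrightarrow>
     (\<forall>x. (\<forall>i\<le>n. x i \<in> A) \<longrightarrow> fst (C x) \<le> n) \<and>
     (\<forall>x y. (\<forall>i\<le>n. x i \<in> A) \<longrightarrow> (\<forall>i\<le>n. y i \<in> A) \<longrightarrow> C x = C y \<longrightarrow>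
        (\<forall>i\<le>n. i \<noteq> fst (C x) \<longrightarrow> x i = y i) \<longrightarrow> x (fst (C x)) = y (fst (C x)))"

text \<open>The coface map: precomposing a tuple with it drops the entry at \<open>p\<close>, and
  applying it to a direction of the shorter tuple gives one of the longer tuple.\<close>

definition skip :: "nat \<Rightarrow> nat \<Rightarrow> nat" where
  "skip p i = (if i < p then i else Suc i)"

lemma skip_eq_iff [simp]: "skip p i = skip p j \<longleftrightarrow> i = j"
  by (auto simp: skip_def)

lemma skip_neq [simp]: "skip p i \<noteq> p" "p \<noteq> skip p i"
  by (auto simp: skip_def)

lemma skip_le: "i \<le> n \<Longrightarrow> skip p i \<le> Suc n"
  by (auto simp: skip_def)

lemma line_separating_Suc:
  fixes r s :: "'a rel"
  assumes r: "Cinfinite r" and s: "Card_order s" and rs: "r =o cardSuc s"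
    and C: "line_separating (Field s) n C"
  shows "\<exists>D. line_separating (Field r) (Suc n) D"
proof -
  obtain e where e: "\<And>b. b \<in> Field r \<Longrightarrow> inj_on (e b) (under r b) \<and> e b ` under r b \<subseteq> Field s"
    using inj_on_under_predecessor[OF r s rs] by metis
  have "\<exists>p. (\<forall>i\<le>Suc n. x i \<in> Field r) \<longrightarrow> p \<le> Suc n \<and> (\<forall>i\<le>Suc n. (x i, x p) \<in> r)" for x
    using Card_order_finite_max[of r "Suc n" x] r by blast
  then obtain p where p: "\<And>x. (\<forall>i\<le>Suc n. x i \<in> Field r) \<Longrightarrow>
      p x \<le> Suc n \<and> (\<forall>i\<le>Suc n. (x i, x (p x)) \<in> r)"
    by metis
  define z where "z x i = e (x (p x)) (x (skip (p x) i))" for x i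
  \<comment> \<open>The label records the position of the chosen maximum, and \<open>skip\<close>
    keeps the direction away from it. Equally coloured tuples on a line in that direction thus share
    the maximum and the injection given by \<open>e\<close>.\<close>
  define D where
    "D x = (skip (p x) (fst (C (z x))), prod_encode (p x, snd (C (z x))))" for x
  have z: "\<forall>i\<le>n. z x i \<in> Field s" if x: "\<forall>i\<le>Suc n. x i \<in> Field r" for x
  proof (intro allI impI)
    fix i assume "i \<le> n"
    then have "x (skip (p x) i) \<in> under r (x (p x))"
      using p[OF x] skip_le unfolding under_def by blast
    then show "z x i \<in> Field s"
      using e[of "x (p x)"] p[OF x] x unfolding z_def by blast
  qed
  have dir: "fst (C (z x)) \<le> n" if "\<forall>i\<le>Suc n. x i \<in> Field r" for x
    using C z[OF that] unfolding line_separating_def by blast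
  have "x (fst (D x)) = y (fst (D x))"
    if x: "\<forall>i\<le>Suc n. x i \<in> Field r" and y: "\<forall>i\<le>Suc n. y i \<in> Field r"
      and D: "D x = D y" and xy: "\<forall>i\<le>Suc n. i \<noteq> fst (D x) \<longrightarrow> x i = y i" for x y
  proof -
    define k where "k = fst (C (z x))"
    have pxy: "p y = p x" and Cxy: "C (z x) = C (z y)"
      using D by (auto simp: D_def prod_eq_iff)
    have fD: "fst (D x) = skip (p x) k"
      by (simp add: D_def k_def)
    have b: "y (p x) = x (p x)"
      using xy p[OF x] fD by simp
    have "\<forall>i\<le>n. i \<noteq> k \<longrightarrow> z x i = z y i"
      using xy fD b pxy skip_le by (simp add: z_def)
    then have "z x k = z y k"
      using C z[OF x] z[OF y] Cxy unfolding line_separating_def k_def by blast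
    then have "e (x (p x)) (x (skip (p x) k)) = e (x (p x)) (y (skip (p x) k))"
      using b pxy by (simp add: z_def)
    moreover have "skip (p x) k \<le> Suc n"
      using skip_le dir[OF x] unfolding k_def by blast
    then have "x (skip (p x) k) \<in> under r (x (p x))" "y (skip (p x) k) \<in> under r (x (p x))"
      using p[OF x] p[OF y] b pxy unfolding under_def by auto
    moreover have "inj_on (e (x (p x))) (under r (x (p x)))"
      using e p[OF x] x by blast
    ultimately show ?thesis
      unfolding fD by (simp add: inj_on_eq_iff)
  qed
  moreover have "fst (D x) \<le> Suc n" if "\<forall>i\<le>Suc n. x i \<in> Field r" for x
    using skip_le[OF dir[OF that]] by (simp add: D_def)
  ultimately have "line_separating (Field r) (Suc n) D"
    unfolding line_separating_def by blast
  then show ?thesis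
    by blast
qed

lemma is_omega_line_separating:
  fixes r :: "'a rel"
  shows "is_omega n r \<Longrightarrow> \<exists>C. line_separating (Field r) n C"
proof (induction n arbitrary: r)
  case 0
  \<comment> \<open>All 1-tuples form a single line in direction 0, so the labels must be injective;
    countability provides them.\<close>
  have "|Field r| =o natLeq"
    using ordIso_transitive[OF card_of_Field_ordIso[OF is_omega_Card_order[OF 0]]] 0 by simp
  then have "|Field r| \<le>o |UNIV :: nat set|"
    using ordIso_ordLeq_trans[OF _ ordIso_imp_ordLeq[OF ordIso_symmetric[OF card_of_nat]]] by blast
  then obtain f :: "'a \<Rightarrow> nat" where "inj_on f (Field r)"
    using card_of_ordLeq[of "Field r" "UNIV :: nat set"] by blast
  then have "line_separating (Field r) 0 (\<lambda>x. (0, f (x 0)))"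
    by (auto simp: line_separating_def inj_on_eq_iff)
  then show ?case
    by blast
next
  case (Suc n)
  then obtain s :: "'a rel" where s: "is_omega n s" "r =o cardSuc s"
    by auto
  then show ?case
    using Suc.IH line_separating_Suc is_omega_Cinfinite[OF Suc.prems] is_omega_Card_order
    by metis
qed

section \<open>Chains with one freely varying entry\<close>

lemma subseq_imp_subset: "subseq xs ys \<Longrightarrow> set xs \<subseteq> set ys"
  by (induction rule: list_emb.induct) auto

lemma subseq_take_mono: "i \<le> j \<Longrightarrow> subseq (take i xs) (take j xs)"
  by (metis min.absorb1 prefix_imp_subseq take_is_prefix take_take)

text \<open>Only the entry at index \<open>k\<close> depends on \<open>X\<close>. For
  \<open>P\<close> of length \<open>k\<close> and \<open>Q\<close> of length \<open>k + 2\<close>,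
  its neighbours, where they exist, are \<open>P\<close> and \<open>Q\<close>; later entries pad
  \<open>Q\<close> to the required length.\<close>

definition chain_through :: "nat \<Rightarrow> 'a \<Rightarrow> 'a list \<Rightarrow> 'a list \<Rightarrow> 'a list \<Rightarrow> nat \<Rightarrow> 'a list list" where
  "chain_through k a P X Q n = map (\<lambda>j. if j < k then take (Suc j) P
     else if j = k then X else Q @ replicate (j - k - 1) a) [0..<Suc n]"

lemma chain_through_in_increasing_chains:
  assumes "length P = k" "length X = Suc k" "length Q = Suc (Suc k)"
    and sub: "subseq P X" "subseq X Q"
    and A: "set Q \<subseteq> A" "a \<in> A"
  shows "chain_through k a P X Q n \<in> increasing_chains A (Suc n)"
proof -
  have set: "set X \<subseteq> A" "set P \<subseteq> A"
    using sub[THEN subseq_imp_subset] A(1) by blast+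
  let ?s = "chain_through k a P X Q n"
  have nth: "?s ! j = (if j < k then take (Suc j) P
     else if j = k then X else Q @ replicate (j - k - 1) a)" if "j < Suc n" for j
    using that by (simp add: chain_through_def del: upt_Suc)
  have "?s ! j \<in> tuples A (j + 1)" if "j < Suc n" for j
    using nth[OF that] assms set by (auto simp: tuples_def dest: in_set_takeD)
  moreover have "subseq (?s ! j) (?s ! (j + 1))" if j: "j + 1 < Suc n" for j
  proof -
    consider "j + 1 < k" | "j + 1 = k" | "j = k" | "k < j"
      by linarith
    then show ?thesis
    proof cases
      case 4
      then have "j - k = Suc (j - k - 1)"
        by simp
      then have "replicate (j - k) a = replicate (j - k - 1) a @ [a]"
        by (metis replicate_Suc replicate_append_same)
      then show ?thesis
        using 4 j by (simp add: nth prefix_imp_subseq)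
    qed (use assms j in \<open>auto simp: nth subseq_take_mono\<close>)
  qed
  ultimately show ?thesis
    by (simp add: increasing_chains_def chain_through_def del: upt_Suc)
qed

text \<open>Both a^(i+1) b^(k-i) and a^i b^(k-i+1) have a^i b^(k-i) as a subsequence and are
  subsequences of a^(i+1) b^(k-i+1), so chains agreeing off index \<open>k\<close> run through them.
  By \<open>indep\<close>, exchanging one b for an a leaves \<open>F\<close> unchanged.\<close>

lemma constant_on_replicates:
  assumes k: "k \<le> n" and ab: "a \<in> A" "b \<in> A"
    and indep: "\<And>\<sigma> \<tau>. \<sigma> \<in> increasing_chains A (Suc n) \<Longrightarrow> \<tau> \<in> increasing_chains A (Suc n) \<Longrightarrow>
      (\<And>i. i \<le> n \<Longrightarrow> i \<noteq> k \<Longrightarrow> \<sigma> ! i = \<tau> ! i) \<Longrightarrow> F (\<sigma> ! k) = F (\<tau> ! k)"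
  shows "F (replicate (Suc k) a) = F (replicate (Suc k) b)"
proof -
  define w where "w i j = replicate i a @ replicate j b" for i j
  have step: "F (w (Suc i) (k - i)) = F (w i (Suc (k - i)))" if i: "i \<le> k" for i
  proof -
    let ?s = "\<lambda>X. chain_through k a (w i (k - i)) X (w (Suc i) (Suc (k - i))) n"
    have chain: "?s X \<in> increasing_chains A (Suc n)"
      if "X = w (Suc i) (k - i) \<or> X = w i (Suc (k - i))" for X
      using that i ab
      by (intro chain_through_in_increasing_chains)
        (auto simp: w_def replicate_append_same[symmetric] simp del: replicate_append_same
          intro!: list_emb_append_mono)
    have nth: "?s X ! k = X" "\<And>i. i \<le> n \<Longrightarrow> i \<noteq> k \<Longrightarrow> ?s X ! i = ?s Y ! i" for X Y
      using k by (simp_all add: chain_through_def del: upt_Suc)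
    show ?thesis
      using indep[OF chain chain nth(2)] nth(1) by metis
  qed
  have "F (w i (Suc k - i)) = F (w 0 (Suc k))" if "i \<le> Suc k" for i
    using that
  proof (induction i)
    case (Suc i)
    then show ?case
      using step[of i] by (simp add: Suc_diff_le)
  qed simp
  from this[of "Suc k"] show ?thesis
    by (simp add: w_def)
qed

theorem theorem4p11:
  fixes n :: nat and r :: "'a rel"
  assumes "is_omega n r"
  shows "\<not> PH n r"
proof
  assume PH: "PH n r"
  have inf: "Cinfinite r"
    by (rule is_omega_Cinfinite[OF assms])
  have order: "trans r" "antisym r"
    using card_order_on_well_order_on[of "Field r" r] inf by (simp_all add: order_on_defs)
  have unbounded: "\<exists>b\<in>Field r. a \<noteq> b \<and> (a, b) \<in> r" if "a \<in> Field r" for a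
    using infinite_Card_order_limit[OF _ _ that] inf unfolding cinfinite_def by blast
  obtain C where C: "line_separating (Field r) n C"
    using is_omega_line_separating[OF assms] by blast
  \<comment> \<open>Colourings in \<open>PH\<close> take values in the naturals, so the pair is
    encoded; decoding the constant \<open>m\<close> gives one direction for all chains.\<close>
  obtain F m where F: "n_cofinal r (n + 1) F"
    and m: "\<And>\<sigma>. \<sigma> \<in> increasing_chains (Field r) (n + 1) \<Longrightarrow>
      prod_encode (C (\<lambda>i. star F \<sigma> ! i)) = m"
    using PH[unfolded PH_def, rule_format, of "\<lambda>xs. prod_encode (C (\<lambda>i. xs ! i))"] by auto
  define k where "k = fst (prod_decode m)"
  have colour: "C (\<lambda>i. star F \<sigma> ! i) = prod_decode m"
    if "\<sigma> \<in> increasing_chains (Field r) (Suc n)" for \<sigma>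
    using m[of \<sigma>] that by (metis Suc_eq_plus1 prod_encode_inverse)
  have entries: "\<forall>i\<le>n. star F \<sigma> ! i \<in> Field r" "\<And>i. i \<le> n \<Longrightarrow> star F \<sigma> ! i = F (\<sigma> ! i)"
    if "\<sigma> \<in> increasing_chains (Field r) (Suc n)" for \<sigma>
    using that F
    by (auto simp: star_def increasing_chains_def n_cofinal_def tuples_def tuples_upto_def)
  have "Field r \<noteq> {}"
    using inf unfolding cinfinite_def by auto
  then obtain a where a: "a \<in> Field r"
    by blast
  \<comment> \<open>One actual chain is needed to see that \<open>m\<close> encodes the colour of a
    tuple, which bounds its direction.\<close>
  have "chain_through 0 a [] [a] [a, a] n \<in> increasing_chains (Field r) (Suc n)"
    using a by (intro chain_through_in_increasing_chains) auto
  then have k: "k \<le> n"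
    using C entries(1) colour unfolding line_separating_def k_def by metis
  have indep: "F (\<sigma> ! k) = F (\<tau> ! k)"
    if \<sigma>: "\<sigma> \<in> increasing_chains (Field r) (Suc n)" and \<tau>: "\<tau> \<in> increasing_chains (Field r) (Suc n)"
      and eq: "\<And>i. i \<le> n \<Longrightarrow> i \<noteq> k \<Longrightarrow> \<sigma> ! i = \<tau> ! i" for \<sigma> \<tau>
  proof -
    \<comment> \<open>The two images have the same colour and lie on one line in direction
      \<open>k\<close>.\<close>
    have "star F \<sigma> ! k = star F \<tau> ! k"
      using C[unfolded line_separating_def, THEN conjunct2, rule_format,
          of "\<lambda>i. star F \<sigma> ! i" "\<lambda>i. star F \<tau> ! i"]
        entries[OF \<sigma>] entries[OF \<tau>] colour[OF \<sigma>] colour[OF \<tau>] eq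
      by (simp add: k_def)
    then show ?thesis
      using entries(2)[OF \<sigma> k] entries(2)[OF \<tau> k] by simp
  qed
  have const: "F (replicate (Suc k) x) = F (replicate (Suc k) a)" if "x \<in> Field r" for x
    by (rule constant_on_replicates[where F = F, OF k that a]) (rule indep)
  have rep: "replicate (Suc k) x \<in> tuples_upto (Field r) (n + 1)"
    "[x] \<in> tuples_upto (Field r) (n + 1)" if "x \<in> Field r" for x
    using that k by (auto simp: tuples_upto_def)
  have bound: "(x, F (replicate (Suc k) a)) \<in> r" if x: "x \<in> Field r" for x
  proof -
    have "subseq [x] (replicate (Suc k) x)"
      by simp
    then have "(F [x], F (replicate (Suc k) x)) \<in> r"
      using F rep[OF x] unfolding n_cofinal_def by blast
    moreover have "(x, F [x]) \<in> r"
      using F x unfolding n_cofinal_def by blast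
    ultimately show ?thesis
      using order(1) const[OF x] by (metis transD)
  qed
  have "F (replicate (Suc k) a) \<in> Field r"
    using F rep(1)[OF a] unfolding n_cofinal_def by blast
  then show False
    using unbounded bound order(2) by (metis antisymD)
qed

end
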